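(* Let $d\ge 1$ be a fixed integer and let $|S_{d,n}|$ denote the number of $d$-dimensional permutations of order $n$. Then, as $n\to\infty$, $$|S_{d,n}| \le \left((1+o(1))\,\frac{n}{e^d}\right)^{n^d}.$$ That is, there is a sequence of real numbers $(\varepsilon_n)_{n\ge 1}$ (depending on $d$) with $\varepsilon_n\to 0$ as $n\to\infty$ such that $|S_{d,n}| \le \left((1+\varepsilon_n)\,n/e^d\right)^{n^d}$ for all $n\ge 1$.
   Context: Write $[n]=\{1,\dots,n\}$. A line of an $[n]^{m}$ array $P$ is a vector of the form $\big(P(i_1,\dots,i_{j-1},t,i_{j+1},\dots,i_m)\big)_{t=1}^n$, where $1\le j\le m$ and $i_1,\dots,i_{j-1},i_{j+1},\dots,i_m\in[n]$ are fixed. A $d$-dimensional permutation of order $n$ is an $[n]^{d+1}$ array of zeros and ones in which every line contains exactly one entry equal to $1$ (and $n-1$ zeros). $S_{d,n}$ denotes the set of all $d$-dimensional permutations of order $n$. *)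

theory Defs
  imports Complex_Main "HOL-Library.FuncSet"
begin

text \<open>
  Arrays, index tuples and lines are extensional functions (constantly \<^term>\<open>undefined\<close>
  outside their domain), so that each object is represented by exactly one function and
  \<^const>\<open>card\<close> counts the mathematical objects.
\<close>

definition array_index :: "nat \<Rightarrow> nat \<Rightarrow> (nat \<Rightarrow> nat) set" where
  "array_index n m = {1..m} \<rightarrow>\<^sub>E {1..n}"

definition arrays :: "nat \<Rightarrow> nat \<Rightarrow> 'a set \<Rightarrow> ((nat \<Rightarrow> nat) \<Rightarrow> 'a) set" where
  "arrays n m A = array_index n m \<rightarrow>\<^sub>E A"

text \<open>
  In a line, \<open>j\<close> is the running coordinate and \<open>i\<close> gives the fixed coordinates
  (all of \<open>{1..m}\<close> except \<open>j\<close>).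
\<close>

definition array_line :: "nat \<Rightarrow> ((nat \<Rightarrow> nat) \<Rightarrow> 'a) \<Rightarrow> nat \<Rightarrow> (nat \<Rightarrow> nat) \<Rightarrow> nat \<Rightarrow> 'a" where
  "array_line n P j i = (\<lambda>t\<in>{1..n}. P (i(j := t)))"

definition array_lines :: "nat \<Rightarrow> nat \<Rightarrow> ((nat \<Rightarrow> nat) \<Rightarrow> 'a) \<Rightarrow> (nat \<Rightarrow> 'a) set" where
  "array_lines n m P =
     {array_line n P j i | j i. j \<in> {1..m} \<and> i \<in> ({1..m} - {j}) \<rightarrow>\<^sub>E {1..n}}"

definition dim_permutations :: "nat \<Rightarrow> nat \<Rightarrow> ((nat \<Rightarrow> nat) \<Rightarrow> nat) set" where
  "dim_permutations d n =
     {P \<in> arrays n (d + 1) {0, 1}.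
        \<forall>v \<in> array_lines n (d + 1) P. \<exists>!t. t \<in> {1..n} \<and> v t = 1}"

lemma finite_dim_permutations: "finite (dim_permutations d n)"
proof -
  have "finite (arrays n (d + 1) {0, 1::nat})"
    unfolding arrays_def array_index_def by (intro finite_PiE) auto
  then show ?thesis
    by (rule rev_finite_subset) (auto simp: dim_permutations_def)
qed

end

theory Submission
  imports Defs "HOL-Real_Asymp.Real_Asymp"
begin

text \<open>
  View a \<open>d\<close>-dimensional permutation as a Latin function \<open>X\<close> from \<open>[n]^d\<close> to \<open>[n]\<close>. Reveal its entries
  along a ranking \<open>s\<close> of the positions, and let \<open>M i X\<close> be the number of values at \<open>i\<close> that are
  consistent with the entries of rank below \<open>s i\<close>. Guessing the entries one after the other shows
  that the sum over \<open>X\<close> of \<open>\<Prod>i. 1 / M i X\<close> is at most \<open>1\<close>. Now take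
  \<open>s j = (\<Sum>k. \<theta> k (j k))\<close> with independent uniform \<open>\<theta> k\<close> from \<open>[n]\<close> to \<open>[n]\<close>. If the value \<open>w\<close>
  occurs in \<open>X\<close> on the line through \<open>i\<close> in direction \<open>k\<close> at coordinate \<open>p k w\<close> with
  \<open>\<theta> k (p k w) < \<theta> k (i k)\<close>, then it is not available at \<open>i\<close>. Given the \<open>\<theta> k (i k)\<close>, a value
  other than \<open>X i\<close> thus survives with probability \<open>u = (\<Prod>k. (n + 1 - \<theta> k (i k)) / n)\<close>, so the
  expectation of \<open>ln M\<close> is at most that of \<open>ln (n u) + 1 / (n u)\<close>, which is \<open>ln n - d + o(1)\<close>.
\<close>

section \<open>The guessing bound for a fixed ranking\<close>

definition choices :: "('i \<Rightarrow> 'v) set \<Rightarrow> 'i set \<Rightarrow> ('i \<Rightarrow> nat) \<Rightarrow> 'i \<Rightarrow> ('i \<Rightarrow> 'v) \<Rightarrow> 'v set" where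
  "choices S I s i X = (\<lambda>Y. Y i) ` {Y \<in> S. \<forall>j\<in>I. s j < s i \<longrightarrow> Y j = X j}"

lemma choices_cong:
  assumes "\<And>j. j \<in> I \<Longrightarrow> s j < s i \<Longrightarrow> X j = X' j"
  shows "choices S I s i X = choices S I s i X'"
  using assms unfolding choices_def by (intro arg_cong[where f = "image _"]) auto

lemma choices_insert:
  assumes "s i \<le> s a"
  shows "choices S (insert a I) s i X = choices S I s i X"
  using assms by (auto simp: choices_def)

text \<open>If each entry is guessed uniformly among its choices given the entries of smaller rank,
  the product is the probability of guessing \<open>Z\<close>, and these probabilities add up to at
  most 1. Tied positions do not inform each other, so rankings with ties are covered. The induction
  adds positions by nondecreasing rank, which leaves the choices at old positions unchanged.\<close>

lemma sum_prod_inverse_choices_le_1: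
  assumes "finite I" "finite S"
  shows "(\<Sum>Z\<in>(\<lambda>X. restrict X I) ` S. \<Prod>i\<in>I. 1 / real (card (choices S I s i Z))) \<le> 1"
  using \<open>finite I\<close>
proof (induction I rule: finite_ranking_induct[where f = s])
  case empty
  have "(\<lambda>X. restrict X {}) ` S \<subseteq> {\<lambda>_. undefined}" by auto
  then have "card ((\<lambda>X. restrict X {}) ` S) \<le> card {\<lambda>_::'a. undefined :: 'b}"
    by (intro card_mono) auto
  then show ?case by (simp only: prod.empty sum_constant) simp
next
  case (insert a I)
  show ?case
  proof (cases "a \<in> I")
    case True
    then show ?thesis using insert.IH by (simp add: insert_absorb)
  next
    case False
    let ?R = "\<lambda>I X. restrict X I"
    let ?p = "\<lambda>Z. \<Prod>i\<in>I. 1 / real (card (choices S I s i Z))"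
    let ?q = "\<lambda>Z. 1 / real (card (choices S I s a Z))"
    have eq: "(\<Prod>i\<in>insert a I. 1 / real (card (choices S (insert a I) s i Z))) = ?q Z * ?p Z" for Z
      using False insert.hyps by (simp add: choices_insert)
    have p_restrict: "?p (?R I Z) = ?p Z" for Z
      by (intro prod.cong refl arg_cong[where f = "\<lambda>x. 1 / real (card x)"] choices_cong) auto
    have q_restrict: "choices S I s a (?R I Z) = choices S I s a Z" for Z
      by (intro choices_cong) auto
    have img: "?R I ` (?R (insert a I) ` S) = ?R I ` S"
      by (force simp: image_image Int_absorb1 restrict_restrict subset_insertI)
    have q_fiber: "?q Z = ?q W" if "?R I Z = W" for Z W
      using q_restrict[of Z] unfolding that by simp
    \<comment> \<open>An element of the fibre is determined by its value at \<open>a\<close>, which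
      lies in the choices at \<open>a\<close>; so there are at most as many terms as their common
      denominator.\<close>
    have fib: "(\<Sum>Z | Z \<in> ?R (insert a I) ` S \<and> ?R I Z = W. ?q Z) \<le> 1" if "W \<in> ?R I ` S" for W
    proof -
      let ?F = "{Z. Z \<in> ?R (insert a I) ` S \<and> ?R I Z = W}"
      have "inj_on (\<lambda>Z. Z a) ?F"
      proof (rule inj_onI)
        fix Z Z' assume Z: "Z \<in> ?F" "Z' \<in> ?F" "Z a = Z' a"
        then have "?R I Z = ?R I Z'" by simp
        then have "Z j = Z' j" if "j \<in> I" for j using that by (metis restrict_apply')
        moreover have "Z j = Z' j" if "j \<notin> insert a I" for j using Z that by auto
        ultimately show "Z = Z'" using Z(3) by (intro ext) (metis insert_iff)
      qed
      moreover have "(\<lambda>Z. Z a) ` ?F \<subseteq> choices S I s a W"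
        by (auto simp: choices_def)
      moreover have "finite (choices S I s a W)" using assms(2) by (simp add: choices_def)
      ultimately have c: "card ?F \<le> card (choices S I s a W)"
        by (meson card_inj_on_le)
      have "(\<Sum>Z\<in>?F. ?q Z) = (\<Sum>Z\<in>?F. 1 / real (card (choices S I s a W)))"
        by (intro sum.cong refl q_fiber) auto
      also have "\<dots> = card ?F / real (card (choices S I s a W))" by simp
      also have "\<dots> \<le> 1" using c by (auto simp: divide_le_eq_1)
      finally show ?thesis .
    qed
    have "(\<Sum>Z\<in>?R (insert a I) ` S. \<Prod>i\<in>insert a I. 1 / real (card (choices S (insert a I) s i Z)))
        = (\<Sum>Z\<in>?R (insert a I) ` S. ?q Z * ?p Z)"
      by (simp only: eq)
    also have "\<dots> = (\<Sum>W\<in>?R I ` S. \<Sum>Z | Z \<in> ?R (insert a I) ` S \<and> ?R I Z = W. ?q Z * ?p Z)"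
      using assms(2) by (subst img[symmetric], intro sum.image_gen) auto
    also have "\<dots> = (\<Sum>W\<in>?R I ` S. (\<Sum>Z | Z \<in> ?R (insert a I) ` S \<and> ?R I Z = W. ?q Z) * ?p W)"
      unfolding sum_distrib_right
      by (intro sum.cong refl arg_cong2[where f = "(*)"]) (use p_restrict in auto)
    also have "\<dots> \<le> (\<Sum>W\<in>?R I ` S. 1 * ?p W)"
      by (intro sum_mono mult_right_mono fib prod_nonneg) auto
    also have "\<dots> \<le> 1" using insert.IH by (simp only: mult_1)
    finally show ?thesis .
  qed
qed

section \<open>Expectations over uniform random functions\<close>

lemma sum_PiE_insert:
  fixes F :: "('a \<Rightarrow> 'b) \<Rightarrow> 'c :: comm_monoid_add"
  assumes "a \<notin> J"
  shows "(\<Sum>f\<in>PiE (insert a J) B. F f) = (\<Sum>x\<in>B a. \<Sum>g\<in>PiE J B. F (g(a := x)))"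
  using sum.reindex[OF inj_combinator[OF assms], where g = F]
  by (simp add: PiE_insert_eq sum.cartesian_product case_prod_unfold comp_def)

text \<open>As an expectation: a single value of a uniform random function is uniform on
  \<open>A\<close>.\<close>

lemma sum_PiE_marginal:
  fixes F :: "'b \<Rightarrow> real"
  assumes "finite J" "a \<in> J" "finite A" "A \<noteq> {}"
  shows "(\<Sum>f\<in>J \<rightarrow>\<^sub>E A. F (f a)) = real (card (J \<rightarrow>\<^sub>E A)) * ((\<Sum>x\<in>A. F x) / card A)"
proof -
  obtain K where K: "J = insert a K" "a \<notin> K" using assms(2) by (meson mk_disjoint_insert)
  have "(\<Sum>f\<in>J \<rightarrow>\<^sub>E A. F (f a)) = (\<Sum>x\<in>A. real (card (K \<rightarrow>\<^sub>E A)) * F x)"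
    using K by (simp add: sum_PiE_insert)
  also have "\<dots> = real (card (J \<rightarrow>\<^sub>E A)) * ((\<Sum>x\<in>A. F x) / card A)"
    using K assms by (simp add: sum_distrib_left[symmetric] card_PiE)
  finally show ?thesis .
qed

text \<open>Values at distinct points are independent: \<open>a\<close> is split off, and the
  one-point marginal handles \<open>b\<close>.\<close>

lemma sum_PiE_marginal2:
  fixes F :: "'b \<Rightarrow> 'b \<Rightarrow> real"
  assumes "finite J" "a \<in> J" "b \<in> J" "a \<noteq> b" "finite A" "A \<noteq> {}"
  shows "(\<Sum>f\<in>J \<rightarrow>\<^sub>E A. F (f a) (f b))
    = real (card (J \<rightarrow>\<^sub>E A)) * ((\<Sum>x\<in>A. \<Sum>y\<in>A. F x y) / (card A)\<^sup>2)"
proof -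
  obtain K where K: "J = insert a K" "a \<notin> K" using assms(2) by (meson mk_disjoint_insert)
  have "b \<in> K" using K assms by auto
  then have "(\<Sum>f\<in>J \<rightarrow>\<^sub>E A. F (f a) (f b)) = (\<Sum>x\<in>A. \<Sum>g\<in>K \<rightarrow>\<^sub>E A. F x (g b))"
    using K assms by (simp add: sum_PiE_insert)
  also have "\<dots> = (\<Sum>x\<in>A. real (card (K \<rightarrow>\<^sub>E A)) * ((\<Sum>y\<in>A. F x y) / card A))"
    using K assms \<open>b \<in> K\<close> by (intro sum.cong refl sum_PiE_marginal) auto
  also have "\<dots> = real (card (J \<rightarrow>\<^sub>E A)) * ((\<Sum>x\<in>A. \<Sum>y\<in>A. F x y) / (card A)\<^sup>2)"
    using K assms
    by (simp add: sum_distrib_left[symmetric] sum_divide_distrib[symmetric] card_PiE power2_eq_square)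
  finally show ?thesis .
qed

lemma sum_atLeastAtMost_rev_real:
  fixes h :: "real \<Rightarrow> real"
  shows "(\<Sum>x=1..m. h (real m + 1 - real x)) = (\<Sum>x=1..m. h (real x))"
proof -
  have "(\<Sum>x=1..m. h (real x)) = (\<Sum>x=1..m. h (real (m + 1 - x)))"
    using sum.atLeastAtMost_rev[of "\<lambda>x. h (real x)" 1 m] by simp
  also have "\<dots> = (\<Sum>x=1..m. h (real m + 1 - real x))"
    by (intro sum.cong refl) (auto simp: of_nat_diff add.commute)
  finally show ?thesis by simp
qed

text \<open>Conditioned on \<open>f a = x\<close>, the event \<open>x \<le> f b\<close> has probability \<open>(m + 1 - x) / m\<close> if
  \<open>b \<noteq> a\<close>, which the weight exactly compensates.\<close>

lemma sum_PiE_survival_weight: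
  fixes n m a b :: nat
  assumes "a \<in> {1..n}" "b \<in> {1..n}" "m \<ge> 1"
  shows "(\<Sum>f\<in>{1..n} \<rightarrow>\<^sub>E {1..m}. of_bool (f a \<le> f b) * (real m / (real m + 1 - real (f a))))
    = real (card ({1..n} \<rightarrow>\<^sub>E {1..m})) * (if a = b then \<Sum>x=1..m. 1 / real x else 1)"
proof (cases "a = b")
  case True
  \<comment> \<open>The event is certain here; reversing \<open>x\<close> to
    \<open>m + 1 - x\<close> turns the mean weight into a harmonic sum.\<close>
  have "(\<Sum>f\<in>{1..n} \<rightarrow>\<^sub>E {1..m}. of_bool (f a \<le> f b) * (real m / (real m + 1 - real (f a))))
      = (\<Sum>f\<in>{1..n} \<rightarrow>\<^sub>E {1..m}. real m / (real m + 1 - real (f a)))"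
    using True by simp
  also have "\<dots> = real (card ({1..n} \<rightarrow>\<^sub>E {1..m}))
      * ((\<Sum>x\<in>{1..m}. real m / (real m + 1 - real x)) / card {1..m})"
    using assms by (intro sum_PiE_marginal[where F = "\<lambda>x. real m / (real m + 1 - real x)"]) auto
  also have "(\<Sum>x\<in>{1..m}. real m / (real m + 1 - real x)) = (\<Sum>x=1..m. real m / real x)"
    by (rule sum_atLeastAtMost_rev_real)
  also have "\<dots> / card {1..m} = (\<Sum>x=1..m. 1 / real x)"
    using assms by (simp add: sum_divide_distrib)
  finally show ?thesis using True by simp
next
  case False
  have row: "(\<Sum>y=1..m. of_bool (x \<le> y) * (real m / (real m + 1 - real x))) = real m"
    if "x \<in> {1..m}" for x :: nat
  proof -
    have "{1..m} \<inter> {y. x \<le> y} = {x..m}" using that by auto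
    then have "(\<Sum>y=1..m. of_bool (x \<le> y) :: real) = real (card {x..m})"
      by (simp add: sum_of_bool_eq)
    also have "\<dots> = real m + 1 - real x" using that by (auto simp: of_nat_diff)
    finally show ?thesis using that by (simp only: sum_distrib_right[symmetric]) simp
  qed
  have "(\<Sum>f\<in>{1..n} \<rightarrow>\<^sub>E {1..m}. of_bool (f a \<le> f b) * (real m / (real m + 1 - real (f a))))
      = real (card ({1..n} \<rightarrow>\<^sub>E {1..m})) * ((\<Sum>x\<in>{1..m}. \<Sum>y\<in>{1..m}.
          of_bool (x \<le> y) * (real m / (real m + 1 - real x))) / (card {1..m})\<^sup>2)"
    using assms False
    by (intro sum_PiE_marginal2[where F = "\<lambda>x y. of_bool (x \<le> y) * (real m / (real m + 1 - real x))"])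
      auto
  also have "(\<Sum>x\<in>{1..m}. \<Sum>y\<in>{1..m}. of_bool (x \<le> y) * (real m / (real m + 1 - real x)))
      = (\<Sum>x\<in>{1..m}. real m)"
    by (intro sum.cong refl row)
  also have "\<dots> / (card {1..m})\<^sup>2 = 1"
    using assms by (simp add: power2_eq_square)
  finally show ?thesis using False by simp
qed

section \<open>The expected logarithm of the number of survivors\<close>

lemma ln_le_tangent:
  fixes x c :: real
  assumes "x > 0" "c > 0"
  shows "ln x \<le> ln c + (x / c - 1)"
  using assms ln_le_minus_one[of "x / c"] by (simp add: ln_div)

text \<open>Here \<open>a\<close> is the current position, \<open>v\<close> its value, and
  \<open>p k w\<close> the coordinate of the value \<open>w\<close> on the line in direction
  \<open>k\<close>. The logarithm is bounded by its tangent at a point that depends only on the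
  ranks \<open>\<theta> k (a k)\<close>. The logarithm of this point is a sum over directions, and
  the ratio to it is a sum of products over directions, so both expectations can be
  computed.\<close>

lemma sum_ln_survivors_le:
  fixes K :: "'k set" and a :: "'k \<Rightarrow> nat" and p :: "'k \<Rightarrow> nat \<Rightarrow> nat" and n m :: nat
  assumes K: "finite K" and m: "m \<ge> 1" and v: "v \<in> {1..n}"
    and a: "\<And>k. k \<in> K \<Longrightarrow> a k \<in> {1..n}"
    and p: "\<And>k w. k \<in> K \<Longrightarrow> w \<in> {1..n} \<Longrightarrow> p k w \<in> {1..n}"
    and pa: "\<And>k w. k \<in> K \<Longrightarrow> w \<in> {1..n} \<Longrightarrow> p k w = a k \<longleftrightarrow> w = v"
  defines "\<Theta> \<equiv> K \<rightarrow>\<^sub>E ({1..n} \<rightarrow>\<^sub>E {1..m})"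
  shows "(\<Sum>\<theta>\<in>\<Theta>. ln (real (card {w \<in> {1..n}. \<forall>k\<in>K. \<theta> k (a k) \<le> \<theta> k (p k w)})))
    \<le> real (card \<Theta>) * (ln n + card K * ((\<Sum>x=1..m. ln (real x / real m)) / m)
        + ((\<Sum>x=1..m. 1 / real x) ^ card K - 1) / n)"
proof -
  let ?B = "{1..n} \<rightarrow>\<^sub>E {1..m}"
  let ?N = "\<lambda>\<theta>. real (card {w \<in> {1..n}. \<forall>k\<in>K. \<theta> k (a k) \<le> \<theta> k (p k w)})"
  let ?r = "\<lambda>\<theta> k. (real m + 1 - real (\<theta> k (a k))) / real m"
  let ?H = "\<Sum>x=1..m. 1 / real x"
  \<comment> \<open>The indicator that \<open>w\<close> survives in direction \<open>k\<close>,
    divided by the conditional probability of this for \<open>w \<noteq> v\<close>.\<close>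
  let ?g = "\<lambda>w k f. of_bool (f (a k) \<le> f (p k w)) * (real m / (real m + 1 - real (f (a k))))"
  define u where "u = (\<lambda>\<theta>. \<Prod>k\<in>K. ?r \<theta> k)"
  have n: "n \<ge> 1" using v by auto
  have finB: "finite ?B" by (intro finite_PiE) auto
  have neB: "?B \<noteq> {}" using m by (auto simp: PiE_eq_empty_iff)
  have cardB: "real (card ?B) \<noteq> 0"
    unfolding of_nat_eq_0_iff card_0_eq[OF finB] by (rule neB)
  have r_pos: "?r \<theta> k > 0" if "\<theta> \<in> \<Theta>" "k \<in> K" for \<theta> k
  proof -
    have "\<theta> k (a k) \<in> {1..m}" using that a[OF that(2)] unfolding \<Theta>_def by (meson PiE_mem)
    then show ?thesis using m by simp
  qed
  have u_pos: "u \<theta> > 0" if "\<theta> \<in> \<Theta>" for \<theta>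
    unfolding u_def using r_pos[OF that] by (intro prod_pos) auto
  have N_pos: "?N \<theta> > 0" if "\<theta> \<in> \<Theta>" for \<theta>
  proof -
    have "v \<in> {w \<in> {1..n}. \<forall>k\<in>K. \<theta> k (a k) \<le> \<theta> k (p k w)}" using v pa[OF _ v] by auto
    then have "card {w \<in> {1..n}. \<forall>k\<in>K. \<theta> k (a k) \<le> \<theta> k (p k w)} \<noteq> 0"
      by (subst card_0_eq) auto
    then show ?thesis by linarith
  qed
  \<comment> \<open>Given the ranks at \<open>a\<close>, a value other than \<open>v\<close>
    survives with probability \<open>u \<theta>\<close>; so the tangent point
    \<open>n * u \<theta>\<close> is the expected count up to the contribution of \<open>v\<close>,
    which always survives.\<close>
  have tangent: "ln (?N \<theta>) \<le> ln n + (\<Sum>k\<in>K. ln (?r \<theta> k)) + (?N \<theta> / (n * u \<theta>) - 1)"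
    if "\<theta> \<in> \<Theta>" for \<theta>
  proof -
    have "ln (?N \<theta>) \<le> ln (n * u \<theta>) + (?N \<theta> / (n * u \<theta>) - 1)"
      using N_pos[OF that] u_pos[OF that] n by (intro ln_le_tangent) auto
    also have "ln (n * u \<theta>) = ln n + ln (u \<theta>)"
      using u_pos[OF that] n by (intro ln_mult_pos) auto
    also have "ln (u \<theta>) = (\<Sum>k\<in>K. ln (?r \<theta> k))"
      unfolding u_def using r_pos[OF that, THEN less_imp_neq, symmetric] by (intro ln_prod K)
    finally show ?thesis .
  qed
  \<comment> \<open>The marginal is taken twice: \<open>\<theta> k\<close> is a uniform random
    function, and its value at \<open>a k\<close> is a uniform rank.\<close>
  have sum_ln: "(\<Sum>\<theta>\<in>\<Theta>. \<Sum>k\<in>K. ln (?r \<theta> k))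
      = real (card \<Theta>) * (card K * ((\<Sum>x=1..m. ln (real x / real m)) / m))"
  proof -
    let ?l = "\<lambda>x. ln ((real m + 1 - real x) / real m)"
    have 1: "(\<Sum>f\<in>?B. ?l (f (a k))) = card ?B * ((\<Sum>x=1..m. ln (real x / real m)) / m)"
      if "k \<in> K" for k
    proof -
      have "(\<Sum>f\<in>?B. ?l (f (a k))) = card ?B * ((\<Sum>x\<in>{1..m}. ?l x) / card {1..m})"
        using a[OF that] m by (intro sum_PiE_marginal[where F = ?l]) auto
      also have "(\<Sum>x\<in>{1..m}. ?l x) = (\<Sum>x=1..m. ln (real x / real m))"
        by (rule sum_atLeastAtMost_rev_real)
      finally show ?thesis by simp
    qed
    have 2: "(\<Sum>\<theta>\<in>\<Theta>. ?l (\<theta> k (a k)))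
        = real (card \<Theta>) * ((\<Sum>x=1..m. ln (real x / real m)) / m)" if "k \<in> K" for k
    proof -
      have "(\<Sum>\<theta>\<in>\<Theta>. ?l (\<theta> k (a k)))
          = real (card \<Theta>) * ((\<Sum>f\<in>?B. ?l (f (a k))) / card ?B)"
        unfolding \<Theta>_def
        by (rule sum_PiE_marginal[where F = "\<lambda>f. ?l (f (a k))", OF K that finB neB])
      also have "(\<Sum>f\<in>?B. ?l (f (a k))) / card ?B = (\<Sum>x=1..m. ln (real x / real m)) / m"
        unfolding 1[OF that] by (intro nonzero_mult_div_cancel_left cardB)
      finally show ?thesis .
    qed
    show ?thesis by (subst sum.swap) (simp add: 2)
  qed
  \<comment> \<open>Both the survival indicator of \<open>w\<close> and \<open>u \<theta>\<close>
    are products over directions, so each factor involves a single \<open>\<theta> k\<close> and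
    independence applies.\<close>
  have ratio: "?N \<theta> / (n * u \<theta>) = (\<Sum>w=1..n. \<Prod>k\<in>K. ?g w k (\<theta> k)) / n" for \<theta>
  proof -
    have "?N \<theta> = (\<Sum>w=1..n. of_bool (\<forall>k\<in>K. \<theta> k (a k) \<le> \<theta> k (p k w)))"
      by (simp add: Int_def)
    also have "\<dots> = (\<Sum>w=1..n. \<Prod>k\<in>K. of_bool (\<theta> k (a k) \<le> \<theta> k (p k w)))"
      using K by (intro sum.cong refl) (auto simp: prod_zero_iff)
    finally have "?N \<theta> / u \<theta>
        = (\<Sum>w=1..n. (\<Prod>k\<in>K. of_bool (\<theta> k (a k) \<le> \<theta> k (p k w))) / u \<theta>)"
      by (simp add: sum_divide_distrib)
    also have "\<dots> = (\<Sum>w=1..n. \<Prod>k\<in>K. ?g w k (\<theta> k))"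
      unfolding u_def prod_dividef[symmetric] by simp
    finally have "?N \<theta> / u \<theta> / n = (\<Sum>w=1..n. \<Prod>k\<in>K. ?g w k (\<theta> k)) / n"
      by (rule arg_cong)
    then show ?thesis by (simp only: divide_divide_eq_left mult.commute[of "u \<theta>"])
  qed
  have weight: "(\<Sum>\<theta>\<in>\<Theta>. \<Prod>k\<in>K. ?g w k (\<theta> k))
      = real (card \<Theta>) * (if w = v then ?H ^ card K else 1)" if w: "w \<in> {1..n}" for w
  proof -
    have "(\<Sum>\<theta>\<in>\<Theta>. \<Prod>k\<in>K. ?g w k (\<theta> k)) = (\<Prod>k\<in>K. \<Sum>f\<in>?B. ?g w k f)"
      unfolding \<Theta>_def using K finB by (intro prod_sum_PiE[symmetric])
    also have "\<dots> = (\<Prod>k\<in>K. real (card ?B) * (if w = v then ?H else 1))"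
    proof (intro prod.cong refl)
      fix k assume k: "k \<in> K"
      show "(\<Sum>f\<in>?B. ?g w k f) = real (card ?B) * (if w = v then ?H else 1)"
        using sum_PiE_survival_weight[OF a[OF k] p[OF k w] m]
        by (simp only: eq_commute[of "a k"] pa[OF k w])
    qed
    also have "\<dots> = real (card \<Theta>) * (if w = v then ?H ^ card K else 1)"
      unfolding \<Theta>_def using K by (simp add: card_PiE power_mult_distrib)
    finally show ?thesis .
  qed
  have sum_ratio: "(\<Sum>\<theta>\<in>\<Theta>. ?N \<theta> / (n * u \<theta>) - 1)
      = real (card \<Theta>) * ((?H ^ card K - 1) / n)"
  proof -
    have "(\<Sum>\<theta>\<in>\<Theta>. ?N \<theta> / (n * u \<theta>))
        = (\<Sum>w=1..n. \<Sum>\<theta>\<in>\<Theta>. \<Prod>k\<in>K. ?g w k (\<theta> k)) / n"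
      unfolding ratio sum_divide_distrib[symmetric] by (subst sum.swap) (rule refl)
    \<comment> \<open>Each value contributes 1 on average, and \<open>v\<close> contributes the
      excess \<open>?H ^ card K - 1\<close> in addition.\<close>
    also have "\<dots> = real (card \<Theta>) * (\<Sum>w=1..n. 1 + (if w = v then ?H ^ card K - 1 else 0)) / n"
      unfolding sum_distrib_left
      by (intro arg_cong[where f = "\<lambda>x. x / real n"] sum.cong refl)
        (simp only: weight, simp)
    also have "(\<Sum>w=1..n. 1 + (if w = v then ?H ^ card K - 1 else 0)) = n + (?H ^ card K - 1)"
      using v by (simp add: sum.distrib)
    finally show ?thesis using n by (simp add: sum_subtractf field_simps)
  qed
  have "(\<Sum>\<theta>\<in>\<Theta>. ln (?N \<theta>))
      \<le> (\<Sum>\<theta>\<in>\<Theta>. ln n + (\<Sum>k\<in>K. ln (?r \<theta> k)) + (?N \<theta> / (n * u \<theta>) - 1))"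
    by (intro sum_mono tangent)
  also have "\<dots> = (\<Sum>\<theta>\<in>\<Theta>. ln n) + (\<Sum>\<theta>\<in>\<Theta>. \<Sum>k\<in>K. ln (?r \<theta> k))
      + (\<Sum>\<theta>\<in>\<Theta>. ?N \<theta> / (n * u \<theta>) - 1)"
    by (simp only: sum.distrib)
  also have "\<dots> = real (card \<Theta>) * (ln n + card K * ((\<Sum>x=1..m. ln (real x / real m)) / m)
        + (?H ^ card K - 1) / n)"
    unfolding sum_ln sum_ratio by (simp only: sum_constant distrib_left)
  finally show ?thesis .
qed

section \<open>Estimates for the logarithmic and harmonic sums\<close>

lemma ln_diff_Suc_le:
  assumes "n \<ge> 1"
  shows "ln (real n) - ln (real (Suc n)) \<le> - 1 / real (Suc n)"
proof -
  have "ln (real n / real (Suc n)) \<le> real n / real (Suc n) - 1"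
    using assms by (intro ln_le_minus_one) simp
  then show ?thesis using assms by (simp add: ln_div field_simps)
qed

text \<open>A weak form of Stirling's formula, \<open>n! \<le> e * n * (n / e) ^ n\<close>. After
  division by \<open>n\<close>, the term \<open>- n\<close> yields the decrease by 1 that each of
  the \<open>d\<close> directions provides.\<close>

lemma sum_ln_le:
  assumes "n \<ge> 1"
  shows "(\<Sum>x=1..n. ln (real x)) \<le> 1 + ln n + n * ln n - n"
  using assms
proof (induction n rule: nat_induct_at_least)
  case base
  then show ?case by simp
next
  case (Suc n)
  have "real (Suc n) * (ln n - ln (Suc n)) \<le> real (Suc n) * (- 1 / real (Suc n))"
    using Suc.hyps by (intro mult_left_mono ln_diff_Suc_le) auto
  then have "real (Suc n) * ln n + 1 \<le> real (Suc n) * ln (Suc n)"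
    by (simp add: algebra_simps)
  then show ?case using Suc.IH by (simp add: algebra_simps)
qed

lemma sum_inverse_le:
  assumes "n \<ge> 1"
  shows "(\<Sum>x=1..n. 1 / real x) \<le> 1 + ln n"
  using assms
proof (induction n rule: nat_induct_at_least)
  case base
  then show ?case by simp
next
  case (Suc n)
  then show ?case using ln_diff_Suc_le[OF Suc.hyps] Suc.IH by simp
qed

section \<open>Latin cubes and the values available in them\<close>

definition latin_cubes :: "nat \<Rightarrow> nat \<Rightarrow> ((nat \<Rightarrow> nat) \<Rightarrow> nat) set" where
  "latin_cubes d n = {X \<in> array_index n d \<rightarrow>\<^sub>E {1..n}.
     \<forall>k\<in>{1..d}. \<forall>i\<in>array_index n d. \<forall>w\<in>{1..n}. \<exists>!t. t \<in> {1..n} \<and> X (i(k := t)) = w}"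

lemma finite_array_index: "finite (array_index n d)"
  unfolding array_index_def by (intro finite_PiE) auto

lemma card_array_index: "card (array_index n d) = n ^ d"
  unfolding array_index_def by (simp add: card_PiE)

lemma finite_latin_cubes: "finite (latin_cubes d n)"
proof -
  have "finite (array_index n d \<rightarrow>\<^sub>E {1..n})"
    by (intro finite_PiE finite_array_index) auto
  then show ?thesis by (rule rev_finite_subset) (auto simp: latin_cubes_def)
qed

lemma array_index_update:
  assumes "i \<in> array_index n d" "k \<in> {1..d}" "t \<in> {1..n}"
  shows "i(k := t) \<in> array_index n d"
  using assms unfolding array_index_def by (auto simp: PiE_iff extensional_def)

text \<open>Lines are defined through tuples lacking coordinate \<open>j\<close>; here they run
  through a full tuple, whose entry at \<open>j\<close> is overwritten anyway. Latin cubes use lines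
  in this form.\<close>

lemma dim_permutations_line:
  assumes P: "P \<in> dim_permutations d n" and i: "i \<in> array_index n (d + 1)" and j: "j \<in> {1..d + 1}"
  shows "\<exists>!t. t \<in> {1..n} \<and> P (i(j := t)) = 1"
proof -
  have "restrict i ({1..d + 1} - {j}) \<in> ({1..d + 1} - {j}) \<rightarrow>\<^sub>E {1..n}"
    using i by (auto simp: array_index_def)
  then have "array_line n P j (restrict i ({1..d + 1} - {j})) \<in> array_lines n (d + 1) P"
    using j unfolding array_lines_def by blast
  then have "\<exists>!t. t \<in> {1..n} \<and> array_line n P j (restrict i ({1..d + 1} - {j})) t = 1"
    using P unfolding dim_permutations_def by blast
  moreover have "(restrict i ({1..d + 1} - {j}))(j := t) = i(j := t)" for t
    using i j by (auto simp: array_index_def PiE_iff extensional_def fun_eq_iff)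
  ultimately show ?thesis by (simp add: array_line_def cong: conj_cong)
qed

lemma array_index_extend:
  assumes "i \<in> array_index n d" "t \<in> {1..n}"
  shows "i(Suc d := t) \<in> array_index n (Suc d)"
  using assms unfolding array_index_def by (auto simp: PiE_iff extensional_def)

text \<open>A permutation is sent to the function giving, over each \<open>d\<close>-tuple, the
  height of the unique 1 in the last direction. Lines in the other directions make this function
  Latin, and the heights determine all entries.\<close>

lemma card_dim_permutations_le:
  assumes "n \<ge> 1"
  shows "card (dim_permutations d n) \<le> card (latin_cubes d n)"
proof (rule card_inj_on_le[OF _ _ finite_latin_cubes])
  let ?I = "array_index n d"
  let ?L = "\<lambda>P. \<lambda>i\<in>?I. THE t. t \<in> {1..n} \<and> P (i(Suc d := t)) = (1::nat)"
  have ex: "\<exists>!t. t \<in> {1..n} \<and> P (i(Suc d := t)) = 1"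
    if P: "P \<in> dim_permutations d n" and i: "i \<in> ?I" for P i
  proof -
    have "i(Suc d := 1) \<in> array_index n (Suc d)" using assms i by (intro array_index_extend) auto
    then have "\<exists>!t. t \<in> {1..n} \<and> P ((i(Suc d := 1))(Suc d := t)) = 1"
      by (intro dim_permutations_line[OF P]) auto
    then show ?thesis by simp
  qed
  have mem: "?L P i \<in> {1..n} \<and> P (i(Suc d := ?L P i)) = 1"
    if "P \<in> dim_permutations d n" "i \<in> ?I" for P i
    using theI'[OF ex[OF that]] that(2) by simp
  have L: "?L P i = t \<longleftrightarrow> P (i(Suc d := t)) = 1"
    if "P \<in> dim_permutations d n" "i \<in> ?I" "t \<in> {1..n}" for P i t
    using mem[OF that(1,2)] ex[OF that(1,2)] that(3) by blast
  show "inj_on ?L (dim_permutations d n)"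
  proof (rule inj_onI)
    fix P Q assume P: "P \<in> dim_permutations d n" and Q: "Q \<in> dim_permutations d n"
      and eq: "?L P = ?L Q"
    have vals: "P \<in> array_index n (Suc d) \<rightarrow>\<^sub>E {0, 1}" "Q \<in> array_index n (Suc d) \<rightarrow>\<^sub>E {0, 1}"
      using P Q by (auto simp: dim_permutations_def arrays_def)
    show "P = Q"
    proof (rule PiE_ext[OF vals])
      fix j assume j: "j \<in> array_index n (Suc d)"
      \<comment> \<open>Index tuples are extensional, so dropping the last coordinate of
        \<open>j\<close> means resetting it to \<open>undefined\<close>.\<close>
      define i where "i = j(Suc d := undefined)"
      have i: "i \<in> ?I" and t: "j (Suc d) \<in> {1..n}"
        using j unfolding i_def array_index_def
        by (auto simp: PiE_iff extensional_def Ball_def le_Suc_eq)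
      have ji: "i(Suc d := j (Suc d)) = j" by (simp add: i_def)
      have "P j = 1 \<longleftrightarrow> Q j = 1"
        using L[OF P i t] L[OF Q i t] unfolding eq ji by blast
      then show "P j = Q j" using PiE_mem[OF vals(1) j] PiE_mem[OF vals(2) j] by auto
    qed
  qed
  show "?L ` dim_permutations d n \<subseteq> latin_cubes d n"
  proof (rule image_subsetI)
    fix P assume P: "P \<in> dim_permutations d n"
    have "\<exists>!t. t \<in> {1..n} \<and> ?L P (i(k := t)) = w"
      if k: "k \<in> {1..d}" and i: "i \<in> ?I" and w: "w \<in> {1..n}" for k i w
    proof -
      \<comment> \<open>The line in direction \<open>k\<close> at height \<open>w\<close> has a
        single 1, and a 1 at height \<open>w\<close> means that the function takes the value
        \<open>w\<close> there.\<close>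
      have "\<exists>!t. t \<in> {1..n} \<and> P ((i(Suc d := w))(k := t)) = 1"
        using array_index_extend[OF i w] k by (intro dim_permutations_line[OF P]) auto
      moreover have "(i(Suc d := w))(k := t) = (i(k := t))(Suc d := w)" for t
        using k by (auto simp: fun_eq_iff)
      moreover have "P ((i(k := t))(Suc d := w)) = 1 \<longleftrightarrow> ?L P (i(k := t)) = w"
        if "t \<in> {1..n}" for t
        using L[OF P array_index_update[OF i k that] w] by auto
      ultimately show ?thesis by (simp cong: conj_cong)
    qed
    then show "?L P \<in> latin_cubes d n" using mem[OF P] unfolding latin_cubes_def by auto
  qed
qed

text \<open>If \<open>\<theta> k (p k w) < \<theta> k (i k)\<close>, moving from \<open>i\<close> to
  the occurrence of \<open>w\<close> in direction \<open>k\<close> lowers the sum of ranks. Every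
  competitor \<open>Y\<close> then agrees with \<open>X\<close> there, and \<open>Y i = w\<close>
  would repeat \<open>w\<close> on that line.\<close>

lemma choices_latin_cubes_subset:
  assumes X: "X \<in> latin_cubes d n" and i: "i \<in> array_index n d"
    and p: "\<And>k w. k \<in> {1..d} \<Longrightarrow> w \<in> {1..n} \<Longrightarrow> p k w \<in> {1..n} \<and> X (i(k := p k w)) = w"
  shows "choices (latin_cubes d n) (array_index n d) (\<lambda>j. \<Sum>k=1..d. \<theta> k (j k)) i X
    \<subseteq> {w \<in> {1..n}. \<forall>k\<in>{1..d}. \<theta> k (i k) \<le> \<theta> k (p k w)}"
proof
  let ?I = "array_index n d" and ?s = "\<lambda>j. \<Sum>k=1..d. \<theta> k (j k) :: nat"
  fix w assume "w \<in> choices (latin_cubes d n) ?I ?s i X"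
  then obtain Y where Y: "Y \<in> latin_cubes d n" and w: "w = Y i"
    and agree: "\<And>j. j \<in> ?I \<Longrightarrow> ?s j < ?s i \<Longrightarrow> Y j = X j"
    unfolding choices_def by auto
  have wn: "w \<in> {1..n}" using Y i unfolding w latin_cubes_def by (auto dest: PiE_mem)
  have "\<theta> k (i k) \<le> \<theta> k (p k w)" if k: "k \<in> {1..d}" for k
  proof (rule ccontr)
    assume less: "\<not> ?thesis"
    let ?j = "i(k := p k w)"
    have j: "?j \<in> ?I" using p[OF k wn] by (intro array_index_update i k) auto
    have "?s ?j < ?s i"
    proof (rule sum_strict_mono_ex1)
      show "\<exists>l\<in>{1..d}. \<theta> l (?j l) < \<theta> l (i l)" using k less by (intro bexI[of _ k]) auto
    qed (use less in auto)
    then have "Y ?j = w" using agree[OF j] p[OF k wn] by simp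
    moreover have "i k \<in> {1..n}" using i k unfolding array_index_def by auto
    moreover have "Y (i(k := i k)) = w" using w by simp
    moreover have "\<exists>!t. t \<in> {1..n} \<and> Y (i(k := t)) = w"
      using Y k i wn unfolding latin_cubes_def by blast
    ultimately have "p k w = i k" using p[OF k wn] by blast
    then show False using less by simp
  qed
  then show "w \<in> {w \<in> {1..n}. \<forall>k\<in>{1..d}. \<theta> k (i k) \<le> \<theta> k (p k w)}" using wn by blast
qed

lemma sum_ln_choices_latin_cubes_le:
  fixes d n m :: nat
  assumes X: "X \<in> latin_cubes d n" and i: "i \<in> array_index n d" and m: "m \<ge> 1"
  defines "\<Theta> \<equiv> {1..d} \<rightarrow>\<^sub>E ({1..n} \<rightarrow>\<^sub>E {1..m})"
  shows "(\<Sum>\<theta>\<in>\<Theta>. ln (real (card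
      (choices (latin_cubes d n) (array_index n d) (\<lambda>j. \<Sum>k=1..d. \<theta> k (j k)) i X))))
    \<le> real (card \<Theta>) * (ln n + d * ((\<Sum>x=1..m. ln (real x / real m)) / m)
        + ((\<Sum>x=1..m. 1 / real x) ^ d - 1) / n)"
proof -
  let ?C = "\<lambda>\<theta>. choices (latin_cubes d n) (array_index n d) (\<lambda>j. \<Sum>k=1..d. \<theta> k (j k)) i X"
  have ex: "\<exists>!t. t \<in> {1..n} \<and> X (i(k := t)) = w" if "k \<in> {1..d}" "w \<in> {1..n}" for k w
    using X i that unfolding latin_cubes_def by blast
  define p where "p = (\<lambda>k w. THE t. t \<in> {1..n} \<and> X (i(k := t)) = w)"
  have p: "p k w \<in> {1..n} \<and> X (i(k := p k w)) = w" if "k \<in> {1..d}" "w \<in> {1..n}" for k w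
    unfolding p_def by (rule theI'[OF ex[OF that]])
  have ik: "i k \<in> {1..n}" if "k \<in> {1..d}" for k using i that unfolding array_index_def by auto
  \<comment> \<open>By uniqueness on each line, \<open>X i\<close> is the value that sits at
    \<open>i\<close> in every direction.\<close>
  have pi: "p k w = i k \<longleftrightarrow> w = X i" if "k \<in> {1..d}" "w \<in> {1..n}" for k w
    using p[OF that] ex[OF that] ik[OF that(1)] by (metis fun_upd_triv)
  let ?N = "\<lambda>\<theta>. card {w \<in> {1..n}. \<forall>k\<in>{1..d}. \<theta> k (i k) \<le> \<theta> k (p k w)}"
  have "ln (real (card (?C \<theta>))) \<le> ln (real (?N \<theta>))" for \<theta>
  proof -
    have "X i \<in> ?C \<theta>" using X unfolding choices_def by auto
    moreover have "finite (?C \<theta>)" using finite_latin_cubes unfolding choices_def by simp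
    ultimately have "card (?C \<theta>) > 0" by (auto simp: card_gt_0_iff)
    moreover have "card (?C \<theta>) \<le> ?N \<theta>"
      by (intro card_mono choices_latin_cubes_subset[OF X i p]) auto
    ultimately show ?thesis by simp
  qed
  then have "(\<Sum>\<theta>\<in>\<Theta>. ln (real (card (?C \<theta>)))) \<le> (\<Sum>\<theta>\<in>\<Theta>. ln (real (?N \<theta>)))"
    by (intro sum_mono)
  also have "\<dots> \<le> real (card \<Theta>) * (ln n + card {1..d} * ((\<Sum>x=1..m. ln (real x / real m)) / m)
        + ((\<Sum>x=1..m. 1 / real x) ^ card {1..d} - 1) / n)"
    unfolding \<Theta>_def
  proof (rule sum_ln_survivors_le)
    show "X i \<in> {1..n}" using X i unfolding latin_cubes_def by (auto dest: PiE_mem)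
  qed (use m ik p pi in auto)
  finally show ?thesis by simp
qed

section \<open>Averaging the guessing bound over rankings\<close>

text \<open>Averaging the bound \<open>sum_prod_inverse_choices_le_1\<close> over a family of rankings and using
  \<open>exp (- t) \<ge> exp (- c) * (1 - (t - c))\<close> plays the role of Jensen's inequality.\<close>

lemma card_le_exp_of_sum_ln_choices_le:
  fixes S :: "('i \<Rightarrow> 'v) set" and s :: "'t \<Rightarrow> 'i \<Rightarrow> nat"
  assumes "finite I" "finite S" "S \<subseteq> extensional I" "finite \<Theta>" "\<Theta> \<noteq> {}"
    and le: "\<And>X i. X \<in> S \<Longrightarrow> i \<in> I \<Longrightarrow>
      (\<Sum>\<theta>\<in>\<Theta>. ln (real (card (choices S I (s \<theta>) i X)))) \<le> real (card \<Theta>) * C"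
  shows "real (card S) \<le> exp C ^ card I"
proof -
  let ?M = "\<lambda>\<theta> i X. real (card (choices S I (s \<theta>) i X))"
  \<comment> \<open>\<open>c\<close> bounds the mean over the rankings of \<open>t\<close>, which is
    minus the logarithm of the probability of guessing \<open>X\<close>.\<close>
  define c where "c = card I * C"
  define t where "t = (\<lambda>\<theta> X. \<Sum>i\<in>I. ln (?M \<theta> i X))"
  have M_pos: "?M \<theta> i X > 0" if "X \<in> S" for \<theta> i X
  proof -
    have "X i \<in> choices S I (s \<theta>) i X" using that unfolding choices_def by auto
    moreover have "finite (choices S I (s \<theta>) i X)" using assms(2) unfolding choices_def by simp
    ultimately show ?thesis by (auto simp: card_gt_0_iff)
  qed
  have exp_t: "exp (- t \<theta> X) = (\<Prod>i\<in>I. 1 / ?M \<theta> i X)" if "X \<in> S" for \<theta> X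
    using assms(1) M_pos[OF that]
    by (simp add: t_def sum_negf[symmetric] exp_sum exp_minus inverse_eq_divide)
  have restr: "(\<lambda>X. restrict X I) ` S = S"
    using assms(3) by (force simp: extensional_restrict)
  have upper: "(\<Sum>X\<in>S. exp (- t \<theta> X)) \<le> 1" for \<theta>
    using sum_prod_inverse_choices_le_1[OF assms(1,2), of "s \<theta>"] by (simp add: restr exp_t)
  have t_le: "(\<Sum>\<theta>\<in>\<Theta>. t \<theta> X) \<le> card \<Theta> * c" if "X \<in> S" for X
  proof -
    have "(\<Sum>\<theta>\<in>\<Theta>. t \<theta> X) = (\<Sum>i\<in>I. \<Sum>\<theta>\<in>\<Theta>. ln (?M \<theta> i X))"
      unfolding t_def by (rule sum.swap)
    also have "\<dots> \<le> (\<Sum>i\<in>I. real (card \<Theta>) * C)"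
      using le[OF that] by (intro sum_mono)
    finally show ?thesis by (simp add: c_def mult_ac)
  qed
  \<comment> \<open>The double sum is estimated both ways: below for each \<open>X\<close> by the
    tangent of \<open>exp\<close>, above for each ranking by 1.\<close>
  have "card \<Theta> * card S * exp (- c) \<le> (\<Sum>X\<in>S. \<Sum>\<theta>\<in>\<Theta>. exp (- t \<theta> X))"
  proof -
    have "card \<Theta> * exp (- c) \<le> (\<Sum>\<theta>\<in>\<Theta>. exp (- t \<theta> X))" if X: "X \<in> S" for X
    proof -
      have "card \<Theta> * exp (- c) \<le> exp (- c) * (card \<Theta> + (card \<Theta> * c - (\<Sum>\<theta>\<in>\<Theta>. t \<theta> X)))"
        using t_le[OF X] by (simp add: mult.commute)
      also have "\<dots> = (\<Sum>\<theta>\<in>\<Theta>. exp (- c) * (1 + (c - t \<theta> X)))"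
        by (simp add: sum_distrib_left[symmetric] sum.distrib sum_subtractf)
      also have "\<dots> \<le> (\<Sum>\<theta>\<in>\<Theta>. exp (- c) * exp (c - t \<theta> X))"
        by (intro sum_mono mult_left_mono exp_ge_add_one_self) auto
      also have "\<dots> = (\<Sum>\<theta>\<in>\<Theta>. exp (- t \<theta> X))" by (simp add: exp_add[symmetric])
      finally show ?thesis .
    qed
    then have "(\<Sum>X\<in>S. card \<Theta> * exp (- c)) \<le> (\<Sum>X\<in>S. \<Sum>\<theta>\<in>\<Theta>. exp (- t \<theta> X))"
      by (rule sum_mono)
    then show ?thesis by (simp add: mult_ac)
  qed
  also have "\<dots> = (\<Sum>\<theta>\<in>\<Theta>. \<Sum>X\<in>S. exp (- t \<theta> X))" by (rule sum.swap)
  also have "\<dots> \<le> (\<Sum>\<theta>\<in>\<Theta>. 1)" by (intro sum_mono upper)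
  finally have "card \<Theta> * (card S * exp (- c)) \<le> real (card \<Theta>) * 1" by (simp add: mult_ac)
  then have "card S * exp (- c) \<le> 1"
    using assms(4,5) by (subst (asm) mult_le_cancel_left_pos) (simp_all add: card_gt_0_iff)
  then have "card S \<le> exp c" by (simp add: exp_minus field_simps)
  also have "exp c = exp C ^ card I" by (simp add: c_def exp_of_nat_mult)
  finally show ?thesis .
qed

section \<open>The asymptotic bound\<close>

lemma card_dim_permutations_le_exp:
  assumes n: "n \<ge> 1"
  shows "real (card (dim_permutations d n))
    \<le> exp (ln n - d + (d * (1 + ln n) / n + (1 + ln n) ^ d / n)) ^ (n ^ d)"
proof -
  let ?C = "ln n + d * ((\<Sum>x=1..n. ln (real x / real n)) / n) + ((\<Sum>x=1..n. 1 / real x) ^ d - 1) / n"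
  let ?D = "ln n - d + (d * (1 + ln n) / n + (1 + ln n) ^ d / n)"
  \<comment> \<open>With \<open>m = n\<close>, the mean logarithms contribute at most
    \<open>- d + d * (1 + ln n) / n\<close>, and the harmonic excess at most
    \<open>(1 + ln n) ^ d / n\<close>.\<close>
  let ?\<Theta> = "{1..d} \<rightarrow>\<^sub>E ({1..n} \<rightarrow>\<^sub>E {1..n})"
  have "real (card (latin_cubes d n)) \<le> exp ?C ^ card (array_index n d)"
  proof (rule card_le_exp_of_sum_ln_choices_le[where \<Theta> = ?\<Theta>
        and s = "\<lambda>\<theta> j. \<Sum>k=1..d. \<theta> k (j k)"])
    show "finite ?\<Theta>" by (intro finite_PiE) auto
    show "?\<Theta> \<noteq> {}" using n by (auto simp: PiE_eq_empty_iff)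
    show "latin_cubes d n \<subseteq> extensional (array_index n d)"
      unfolding latin_cubes_def by (auto simp: PiE_iff)
  qed (use n finite_latin_cubes finite_array_index sum_ln_choices_latin_cubes_le in auto)
  also have "\<dots> \<le> exp ?D ^ (n ^ d)"
  proof -
    have "(\<Sum>x=1..n. ln (real x / real n)) = (\<Sum>x=1..n. ln (real x) - ln n)"
      by (intro sum.cong refl) (simp add: ln_div)
    also have "\<dots> = (\<Sum>x=1..n. ln (real x)) - n * ln n" by (simp add: sum_subtractf)
    also have "\<dots> \<le> 1 + ln n - n" using sum_ln_le[OF n] by simp
    finally have "(\<Sum>x=1..n. ln (real x / real n)) / n \<le> (1 + ln n - n) / n"
      by (intro divide_right_mono) auto
    then have "d * ((\<Sum>x=1..n. ln (real x / real n)) / n) \<le> d * ((1 + ln n - n) / n)"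
      by (intro mult_left_mono) auto
    also have "\<dots> = d * (1 + ln n) / n - d" using n by (simp add: field_simps)
    finally have 1: "d * ((\<Sum>x=1..n. ln (real x / real n)) / n) \<le> d * (1 + ln n) / n - d" .
    have "(\<Sum>x=1..n. 1 / real x) ^ d \<le> (1 + ln n) ^ d"
      by (intro power_mono sum_inverse_le n sum_nonneg) auto
    then have "((\<Sum>x=1..n. 1 / real x) ^ d - 1) / n \<le> (1 + ln n) ^ d / n"
      by (intro divide_right_mono) auto
    with 1 have "?C \<le> ?D" by linarith
    then show ?thesis unfolding card_array_index by (intro power_mono) auto
  qed
  finally show ?thesis using card_dim_permutations_le[OF n, of d] by linarith
qed

lemma ln_power_over_self_tendsto_0:
  "(\<lambda>n. (1 + ln (real n)) ^ d / real n) \<longlonglongrightarrow> 0"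
  by real_asymp

theorem theorem1p4:
  fixes d :: nat
  assumes "d \<ge> 1"
  shows "\<exists>\<epsilon> :: nat \<Rightarrow> real. \<epsilon> \<longlonglongrightarrow> 0 \<and>
    (\<forall>n\<ge>1. real (card (dim_permutations d n)) \<le> ((1 + \<epsilon> n) * (real n / exp 1 ^ d)) ^ (n ^ d))"
proof -
  let ?\<delta> = "\<lambda>n. d * (1 + ln (real n)) / n + (1 + ln (real n)) ^ d / n"
  \<comment> \<open>Chosen so that \<open>1 + ?\<epsilon> n\<close> is the exponential of the error,
    while \<open>exp (ln n - d)\<close> gives \<open>n / exp 1 ^ d\<close>.\<close>
  let ?\<epsilon> = "\<lambda>n. exp (?\<delta> n) - 1"
  \<comment> \<open>The power 1 brings the first error term into the form of the second, so one
    limit serves both.\<close>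
  have "(\<lambda>n. d * ((1 + ln (real n)) ^ 1 / n) + (1 + ln (real n)) ^ d / n) \<longlonglongrightarrow> real d * 0 + 0"
    by (intro tendsto_intros ln_power_over_self_tendsto_0)
  then have "(\<lambda>n. exp (?\<delta> n)) \<longlonglongrightarrow> exp 0" by (intro tendsto_exp) simp
  then have "?\<epsilon> \<longlonglongrightarrow> 0" by (simp add: LIM_zero_iff)
  moreover have "real (card (dim_permutations d n)) \<le> ((1 + ?\<epsilon> n) * (real n / exp 1 ^ d)) ^ (n ^ d)"
    if "n \<ge> 1" for n
  proof -
    have "exp (ln n - d + ?\<delta> n) = exp (ln n) / exp (real d * 1) * exp (?\<delta> n)"
      unfolding exp_add[of "ln n - d"] exp_diff[of "ln n"] mult_1_right ..
    also have "\<dots> = (1 + ?\<epsilon> n) * (real n / exp 1 ^ d)"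
      unfolding exp_of_nat_mult using that by simp
    finally show ?thesis using card_dim_permutations_le_exp[OF that, of d] by (simp only:)
  qed
  ultimately show ?thesis by blast
qed

end
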